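(* Let $G=(V,E)$ be a finite weighted graph, let $\Omega\subseteq V$ be a domain such that $\Omega^\circ\neq\emptyset$, and let $\Delta_\Omega$ be the Dirichlet Laplacian on $\Omega^\circ$. Let $N=\#\Omega^\circ$ and let $\{\varphi_k\}_{k=1}^N$ be an orthonormal basis of $W_0^{1,2}(\Omega)$ consisting of eigenfunctions of $-\Delta_\Omega$, with $-\Delta_\Omega\varphi_k=\lambda_k\varphi_k$ for $k=1,\dots,N$, where $\lambda_k>0$. Let $g,h:\Omega^\circ\to\mathbb{R}$ and let $f:[0,\infty)\times\Omega^\circ\to\mathbb{R}$ be continuous with respect to $t$. If $$f(t,x)=\sum_{k=1}^N b_k(t)\varphi_k(x),\qquad g(x)=\sum_{k=1}^N g_k\varphi_k(x),\qquad h(x)=\sum_{k=1}^N h_k\varphi_k(x)$$ (with $b_k:[0,\infty)\to\mathbb{R}$ and $g_k,h_k\in\mathbb{R}$), then the solution of the problem $$\begin{cases}\partial_t^2u(t,x)-\Delta_\Omega u(t,x)=f(t,x), & (t,x)\in[0,\infty)\times\Omega^\circ,\\ u(0,x)=g(x), & x\in\Omega^\circ,\\ \partial_tu(0,x)=h(x), & x\in\Omega^\circ,\\ u(t,x)=0, & (t,x)\in[0,\infty)\times\partial\Omega\end{cases}$$ is given by $$u(t,x)=\sum_{k=1}^N\frac{1}{\sqrt{\lambda_k}}\int_0^t\sin\big(\sqrt{\lambda_k}(t-s)\big)b_k(s)\,ds\cdot\varphi_k(x)+\sum_{k=1}^N g_k\cos(\sqrt{\lambda_k}\,t)\varphi_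k(x)+\sum_{k=1}^N\frac{1}{\sqrt{\lambda_k}}h_k\sin(\sqrt{\lambda_k}\,t)\varphi_k(x).$$
   Context: A finite weighted graph $G=(V,E)$ is a finite graph with vertex set $V$ and edge set $E$ (write $y\sim x$ if $xy\in E$), with edge weights $\omega_{xy}=\omega_{yx}>0$ for every $xy\in E$, together with a positive finite measure $\mu:V\to(0,\infty)$. A domain $\Omega\subseteq V$ is a non-empty connected set of vertices. Its boundary is the set $\partial\Omega:=\{x\in\Omega:\text{ there exists }y\in\Omega^c\text{ with }y\sim x\}$ (a subset of $\Omega$), and its interior is $\Omega^\circ:=\Omega\setminus\partial\Omega$. For a function $u$ on $\Omega^\circ$, the Dirichlet Laplacian is $$\Delta_\Omega u(x)=\frac{1}{\mu(x)}\sum_{y\sim x}\omega_{xy}\,(u(y)-u(x)),\qquad x\in\Omega^\circ,$$ where $u(y):=0$ whenever $y\notin\Omega^\circ$; it is applied to $u(t,\cdot)$ for each fixed $t$. Since $V$ is finite, $W_0^{1,2}(\Omega)$ is, as a vector space, the $N$-dimensional space of all functions $\Omega\to\mathbb{R}$ vanishing on $\partial\Omega$ (identified with the functions on $\Omega^\circ$); orthonormality is with respect to the inner product $\langle u,v\rangle=\sum_{x\in\Omega}u(x)v(x)\mu(x)$. A function $u:[0,\infty)\times\Omega\to\mathbb{R}$ is a solution of the problem if $u$ is twice continuously differentiable with respect to $t$ and all the equations of the problem are satisfied (derivatives at $t=0$ are one-sided). *)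

theory Defs
  imports "HOL-Analysis.Analysis" "Graph_Theory.Graph_Theory"
begin

(* An undirected edge xy is represented by the two arcs (x,y) and (y,x), so that y ~ x is
   (x,y) : parcs G.  The locale pair_pseudo_graph requires finitely many vertices and a symmetric
   arc relation on them; loops are not excluded (they do not contribute to the boundary or to the
   Laplacian).  The values of w off the arcs and of m off the vertices are irrelevant. *)
locale weighted_graph = pair_pseudo_graph G
  for G :: "'a pair_pre_digraph" +
  fixes w :: "'a \<Rightarrow> 'a \<Rightarrow> real" and m :: "'a \<Rightarrow> real"
  assumes weight_pos: "(x, y) \<in> parcs G \<Longrightarrow> w x y > 0"
    and weight_sym: "(x, y) \<in> parcs G \<Longrightarrow> w x y = w y x"
    and measure_pos: "x \<in> pverts G \<Longrightarrow> m x > 0"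

(* Connectedness is that of the induced subgraph.  The qualified name avoids the topological
   predicate of the same name. *)
definition is_domain :: "'a pair_pre_digraph \<Rightarrow> 'a set \<Rightarrow> bool" where
  "is_domain G \<Omega> \<longleftrightarrow>
     \<Omega> \<noteq> {} \<and> \<Omega> \<subseteq> pverts G \<and> Digraph_Component.connected (induce_subgraph (with_proj G) \<Omega>)"

definition vertex_boundary :: "'a pair_pre_digraph \<Rightarrow> 'a set \<Rightarrow> 'a set" where
  "vertex_boundary G \<Omega> = {x \<in> \<Omega>. \<exists>y \<in> pverts G - \<Omega>. (x, y) \<in> parcs G}"

definition vertex_interior :: "'a pair_pre_digraph \<Rightarrow> 'a set \<Rightarrow> 'a set" where
  "vertex_interior G \<Omega> = \<Omega> - vertex_boundary G \<Omega>"

(* Meaningful for x in the interior; depends only on the values of u there. *)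
definition dirichlet_laplacian ::
  "'a pair_pre_digraph \<Rightarrow> ('a \<Rightarrow> 'a \<Rightarrow> real) \<Rightarrow> ('a \<Rightarrow> real) \<Rightarrow> 'a set \<Rightarrow> ('a \<Rightarrow> real) \<Rightarrow> 'a \<Rightarrow> real" where
  "dirichlet_laplacian G w m \<Omega> u x =
     (1 / m x) * (\<Sum>y | (x, y) \<in> parcs G.
        w x y * ((if y \<in> vertex_interior G \<Omega> then u y else 0) - u x))"

(* Functions on \<Omega> are represented by total functions whose values off \<Omega> are ignored; two of them
   are identified if they agree on \<Omega>. *)
definition W012 :: "'a pair_pre_digraph \<Rightarrow> 'a set \<Rightarrow> ('a \<Rightarrow> real) set" where
  "W012 G \<Omega> = {u. \<forall>x \<in> vertex_boundary G \<Omega>. u x = 0}"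

definition inner_dom :: "('a \<Rightarrow> real) \<Rightarrow> 'a set \<Rightarrow> ('a \<Rightarrow> real) \<Rightarrow> ('a \<Rightarrow> real) \<Rightarrow> real" where
  "inner_dom m \<Omega> u v = (\<Sum>x\<in>\<Omega>. u x * v x * m x)"

(* Linear independence follows from orthonormality. *)
definition orthonormal_basis_W012 ::
  "'a pair_pre_digraph \<Rightarrow> ('a \<Rightarrow> real) \<Rightarrow> 'a set \<Rightarrow> nat \<Rightarrow> (nat \<Rightarrow> 'a \<Rightarrow> real) \<Rightarrow> bool" where
  "orthonormal_basis_W012 G m \<Omega> N \<phi> \<longleftrightarrow>
     (\<forall>k\<in>{1..N}. \<phi> k \<in> W012 G \<Omega>) \<and>
     (\<forall>j\<in>{1..N}. \<forall>k\<in>{1..N}. inner_dom m \<Omega> (\<phi> j) (\<phi> k) = (if j = k then 1 else 0)) \<and>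
     (\<forall>u\<in>W012 G \<Omega>. \<exists>c. \<forall>x\<in>\<Omega>. u x = (\<Sum>k=1..N. c k * \<phi> k x))"

(* Here du and ddu are the first and second time derivatives of u; differentiating within {0..}
   makes them one-sided at t = 0. *)
definition wave_solution ::
  "'a pair_pre_digraph \<Rightarrow> ('a \<Rightarrow> 'a \<Rightarrow> real) \<Rightarrow> ('a \<Rightarrow> real) \<Rightarrow> 'a set \<Rightarrow>
   (real \<Rightarrow> 'a \<Rightarrow> real) \<Rightarrow> ('a \<Rightarrow> real) \<Rightarrow> ('a \<Rightarrow> real) \<Rightarrow> (real \<Rightarrow> 'a \<Rightarrow> real) \<Rightarrow> bool" where
  "wave_solution G w m \<Omega> f g h u \<longleftrightarrow>
     (\<exists>du ddu.
        (\<forall>x\<in>\<Omega>.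
           (\<forall>t\<ge>0. ((\<lambda>s. u s x) has_real_derivative du t x) (at t within {0..})) \<and>
           (\<forall>t\<ge>0. ((\<lambda>s. du s x) has_real_derivative ddu t x) (at t within {0..})) \<and>
           continuous_on {0..} (\<lambda>t. ddu t x)) \<and>
        (\<forall>t\<ge>0. \<forall>x\<in>vertex_interior G \<Omega>. ddu t x - dirichlet_laplacian G w m \<Omega> (u t) x = f t x) \<and>
        (\<forall>x\<in>vertex_interior G \<Omega>. u 0 x = g x) \<and>
        (\<forall>x\<in>vertex_interior G \<Omega>. du 0 x = h x) \<and>
        (\<forall>t\<ge>0. \<forall>x\<in>vertex_boundary G \<Omega>. u t x = 0))"

end

theory Submission
  imports Defs
begin

(* Expanding in the eigenbasis decouples the wave equation into the scalar equations
   c'' + lam c = b for the coefficients c = inner_dom m \<Omega> u \<phi>.  These are solved by Duhamel's formula,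
   uniquely because c'^2 + lam c^2 is conserved when b = 0. *)

section \<open>The forced harmonic oscillator\<close>

text \<open>The fundamental theorem of calculus applies on the compact interval
  \<open>{0..t + 1}\<close>, which agrees with the half-line near \<open>t\<close>. At
  \<open>t = 0\<close> the derivative is one-sided.\<close>

lemma integral_from_zero_has_real_derivative:
  fixes p :: "real \<Rightarrow> real"
  assumes "continuous_on {0..} p" and "t \<ge> 0"
  shows "((\<lambda>t. integral {0..t} p) has_real_derivative p t) (at t within {0..})"
proof -
  have "continuous_on {0..t + 1} p"
    using assms(1) by (rule continuous_on_subset) auto
  then have "((\<lambda>t. integral {0..t} p) has_real_derivative p t) (at t within {0..t + 1})"
    using assms(2) by (intro integral_has_real_derivative) auto
  moreover have "at t within {0..t + 1} = at t within {0..}"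
    by (rule at_within_nhd[where S = "{..<t + 1}"]) auto
  ultimately show ?thesis by simp
qed

text \<open>Duhamel's solution of \<open>y'' + l y = b\<close> with \<open>y 0 = p\<close> and
  \<open>y' 0 = q\<close> for \<open>l > 0\<close>. The three summands are written as in the final
  theorem, so that matching them there only takes distributing the factor
  \<open>\<phi> k x\<close>.\<close>

definition oscillator :: "real \<Rightarrow> (real \<Rightarrow> real) \<Rightarrow> real \<Rightarrow> real \<Rightarrow> real \<Rightarrow> real" where
  "oscillator l b p q t =
     1 / sqrt l * integral {0..t} (\<lambda>s. sin (sqrt l * (t - s)) * b s)
     + p * cos (sqrt l * t) + 1 / sqrt l * q * sin (sqrt l * t)"

(* The addition theorem moves t out of the integrand, so that only the fundamental theorem of
   calculus is needed to differentiate. *)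
lemma oscillator_eq:
  assumes "continuous_on {0..} b"
  shows "oscillator l b p q t =
     1 / sqrt l * (sin (sqrt l * t) * integral {0..t} (\<lambda>s. cos (sqrt l * s) * b s)
                   - cos (sqrt l * t) * integral {0..t} (\<lambda>s. sin (sqrt l * s) * b s))
     + p * cos (sqrt l * t) + 1 / sqrt l * q * sin (sqrt l * t)"
proof -
  have b: "continuous_on {0..t} b"
    using assms by (rule continuous_on_subset) auto
  have c: "(\<lambda>s. cos (sqrt l * s) * b s) integrable_on {0..t}"
    and s: "(\<lambda>s. sin (sqrt l * s) * b s) integrable_on {0..t}"
    using b by (auto intro!: integrable_continuous_real continuous_intros)
  have "integral {0..t} (\<lambda>s. sin (sqrt l * (t - s)) * b s) =
        integral {0..t} (\<lambda>s. sin (sqrt l * t) * (cos (sqrt l * s) * b s)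
                             - cos (sqrt l * t) * (sin (sqrt l * s) * b s))"
    by (simp add: right_diff_distrib sin_diff left_diff_distrib mult.assoc)
  also have "\<dots> = integral {0..t} (\<lambda>s. sin (sqrt l * t) * (cos (sqrt l * s) * b s))
                 - integral {0..t} (\<lambda>s. cos (sqrt l * t) * (sin (sqrt l * s) * b s))"
    by (intro integral_diff integrable_on_mult_right c s)
  finally show ?thesis
    by (simp add: oscillator_def)
qed

text \<open>Variation of constants: on differentiating once, the terms coming from the two integrals
  cancel; on differentiating again, they add up to \<open>b t\<close> because the squares of sine
  and cosine sum to 1.\<close>

lemma oscillator_solution:
  assumes b: "continuous_on {0..} b" and l: "l > 0"
  obtains v where
    "\<And>t. t \<ge> 0 \<Longrightarrow> (oscillator l b p q has_real_derivative v t) (at t within {0..})"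
    "\<And>t. t \<ge> 0 \<Longrightarrow> (v has_real_derivative b t - l * oscillator l b p q t) (at t within {0..})"
    "v 0 = q"
proof
  define r where "r = sqrt l"
  define C where "C = (\<lambda>t. integral {0..t} (\<lambda>s. cos (r * s) * b s))"
  define S where "S = (\<lambda>t. integral {0..t} (\<lambda>s. sin (r * s) * b s))"
  \<comment> \<open>The derivative of the oscillator after the two terms containing
    \<open>b t\<close> have cancelled.\<close>
  define v where "v = (\<lambda>t. cos (r * t) * C t + sin (r * t) * S t - p * r * sin (r * t) + q * cos (r * t))"
  have r: "r > 0" "l = r * r" using l by (auto simp: r_def)
  have o: "oscillator l b p q =
      (\<lambda>t. 1 / r * (sin (r * t) * C t - cos (r * t) * S t) + p * cos (r * t) + 1 / r * q * sin (r * t))"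
    unfolding oscillator_eq[OF b] C_def S_def r_def by (rule ext) simp
  have C [derivative_intros]: "(C has_real_derivative cos (r * t) * b t) (at t within {0..})"
    and S [derivative_intros]: "(S has_real_derivative sin (r * t) * b t) (at t within {0..})"
    if "t \<ge> 0" for t
    unfolding C_def S_def using b that
    by (auto intro!: integral_from_zero_has_real_derivative continuous_intros)
  \<comment> \<open>The Pythagorean identity, directed so as to eliminate squares of the sine; the
    factor \<open>y\<close> lets it match inside expanded products.\<close>
  have sc: "y * (sin x * sin x) = y - y * (cos x * cos x)" for x y :: real
    by (simp add: sin_squared_eq[unfolded power2_eq_square] right_diff_distrib)
  show "(oscillator l b p q has_real_derivative v t) (at t within {0..})" if "t \<ge> 0" for t
    unfolding o v_def using that r(1)
    by (auto intro!: derivative_eq_intros simp: field_simps)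
  show "(v has_real_derivative b t - l * oscillator l b p q t) (at t within {0..})" if "t \<ge> 0" for t
    unfolding o v_def unfolding r(2) using that r(1)
    by (auto intro!: derivative_eq_intros simp: field_simps sc)
  show "v 0 = q" by (simp add: v_def C_def S_def)
qed

lemma oscillator_0: "oscillator l b p q 0 = p"
  by (simp add: oscillator_def)

text \<open>Energy method: the difference of two solutions with the same initial data solves the
  unforced equation, so its energy is constant and starts at 0.\<close>

lemma oscillator_unique:
  assumes b: "continuous_on {0..} b" and l: "l > 0"
    and c: "\<And>t. t \<ge> 0 \<Longrightarrow> (c has_real_derivative d t) (at t within {0..})"
    and d: "\<And>t. t \<ge> 0 \<Longrightarrow> (d has_real_derivative b t - l * c t) (at t within {0..})"
    and t: "t \<ge> 0"
  shows "c t = oscillator l b (c 0) (d 0) t"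
proof -
  let ?o = "oscillator l b (c 0) (d 0)"
  obtain v where o: "\<And>t. t \<ge> 0 \<Longrightarrow> (?o has_real_derivative v t) (at t within {0..})"
    and v: "\<And>t. t \<ge> 0 \<Longrightarrow> (v has_real_derivative b t - l * ?o t) (at t within {0..})"
    and v0: "v 0 = d 0"
    using oscillator_solution[OF b l] by blast
  \<comment> \<open>The energy of the difference. The forcing \<open>b\<close> cancels in it, and
    the derivatives of the kinetic and potential terms are opposite.\<close>
  define E where "E = (\<lambda>t. (d t - v t)\<^sup>2 + l * (c t - ?o t)\<^sup>2)"
  have "(E has_field_derivative 0) (at t within {0..})" if "t \<in> {0..}" for t
    unfolding E_def using that
    by (auto intro!: derivative_eq_intros c d o v simp: algebra_simps)
  then obtain K where "\<And>t. t \<in> {0..} \<Longrightarrow> E t = K"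
    using has_field_derivative_zero_constant[of "{0..}" E] by (auto simp: convex_real_interval)
  then have "E t = E 0" using t by simp
  also have "\<dots> = 0" by (simp add: E_def v0 oscillator_0)
  finally have "l * (c t - ?o t)\<^sup>2 = 0"
    using l unfolding E_def by (simp add: add_nonneg_eq_0_iff)
  then show ?thesis using l by simp
qed

section \<open>Expansion in an orthonormal basis\<close>

text \<open>Boundary values of \<open>v\<close> are killed by the factor \<open>\<phi> k\<close>, so
  an expansion on the interior determines the coefficients. The data \<open>f\<close>,
  \<open>g\<close>, \<open>h\<close> and the second derivative of a solution are expanded only
  there.\<close>

lemma W012_coefficient:
  assumes basis: "orthonormal_basis_W012 G m \<Omega> N \<phi>" and k: "k \<in> {1..N}"
    and v: "\<And>x. x \<in> vertex_interior G \<Omega> \<Longrightarrow> v x = (\<Sum>j=1..N. a j * \<phi> j x)"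
  shows "inner_dom m \<Omega> v (\<phi> k) = a k"
proof -
  have "inner_dom m \<Omega> v (\<phi> k) = (\<Sum>x\<in>\<Omega>. \<Sum>j=1..N. a j * (\<phi> j x * \<phi> k x * m x))"
    unfolding inner_dom_def
  proof (rule sum.cong[OF refl])
    fix x assume "x \<in> \<Omega>"
    show "v x * \<phi> k x * m x = (\<Sum>j=1..N. a j * (\<phi> j x * \<phi> k x * m x))"
    proof (cases "x \<in> vertex_boundary G \<Omega>")
      case True
      then have "\<phi> k x = 0"
        using basis k by (auto simp: orthonormal_basis_W012_def W012_def)
      then show ?thesis by simp
    next
      case False
      then have "x \<in> vertex_interior G \<Omega>"
        using \<open>x \<in> \<Omega>\<close> by (simp add: vertex_interior_def)
      then show ?thesis by (simp add: v sum_distrib_right mult.assoc)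
    qed
  qed
  also have "\<dots> = (\<Sum>j=1..N. a j * inner_dom m \<Omega> (\<phi> j) (\<phi> k))"
    by (subst sum.swap) (simp add: inner_dom_def sum_distrib_left)
  also have "\<dots> = (\<Sum>j=1..N. if j = k then a j else 0)"
    using basis k by (intro sum.cong) (auto simp: orthonormal_basis_W012_def)
  also have "\<dots> = a k" using k by simp
  finally show ?thesis .
qed

text \<open>Spanning supplies some coefficients; orthonormality identifies them with the inner
  products.\<close>

lemma W012_expansion:
  assumes basis: "orthonormal_basis_W012 G m \<Omega> N \<phi>" and v: "v \<in> W012 G \<Omega>" and x: "x \<in> \<Omega>"
  shows "v x = (\<Sum>k=1..N. inner_dom m \<Omega> v (\<phi> k) * \<phi> k x)"
proof -
  obtain a where a: "\<And>x. x \<in> \<Omega> \<Longrightarrow> v x = (\<Sum>k=1..N. a k * \<phi> k x)"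
    using basis v by (auto simp: orthonormal_basis_W012_def)
  then have "inner_dom m \<Omega> v (\<phi> k) = a k" if "k \<in> {1..N}" for k
    using W012_coefficient[OF basis that] by (simp add: vertex_interior_def)
  then show ?thesis using a[OF x] by simp
qed

text \<open>The operator is linear and reads its argument only on the interior, so an expansion
  valid there suffices.\<close>

lemma dirichlet_laplacian_sum:
  assumes x: "x \<in> vertex_interior G \<Omega>"
    and v: "\<And>y. y \<in> vertex_interior G \<Omega> \<Longrightarrow> v y = (\<Sum>k\<in>K. a k * \<phi> k y)"
  shows "dirichlet_laplacian G w m \<Omega> v x = (\<Sum>k\<in>K. a k * dirichlet_laplacian G w m \<Omega> (\<phi> k) x)"
proof -
  have "w x y * ((if y \<in> vertex_interior G \<Omega> then v y else 0) - v x) =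
      (\<Sum>k\<in>K. a k * (w x y * ((if y \<in> vertex_interior G \<Omega> then \<phi> k y else 0) - \<phi> k x)))" for y
    by (simp add: v x right_diff_distrib sum_subtractf sum_distrib_left sum_negf mult.left_commute)
  then have "dirichlet_laplacian G w m \<Omega> v x = 1 / m x * (\<Sum>k\<in>K. a k *
      (\<Sum>y | (x, y) \<in> parcs G. w x y * ((if y \<in> vertex_interior G \<Omega> then \<phi> k y else 0) - \<phi> k x)))"
    unfolding dirichlet_laplacian_def by (subst sum_distrib_left, subst sum.swap) simp
  then show ?thesis
    by (simp add: dirichlet_laplacian_def sum_distrib_left sum_divide_distrib mult.left_commute)
qed

lemma inner_dom_has_real_derivative:
  assumes "\<And>x. x \<in> \<Omega> \<Longrightarrow> ((\<lambda>s. u s x) has_real_derivative u' x) (at t within T)"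
  shows "((\<lambda>s. inner_dom m \<Omega> (u s) v) has_real_derivative inner_dom m \<Omega> u' v) (at t within T)"
  unfolding inner_dom_def by (auto intro!: DERIV_sum DERIV_cmult_right assms)


text \<open>The equivalence holds for every \<open>u\<close>: right to left, the formula gives a
  solution; left to right, that solution is unique as a function of \<open>t \<ge> 0\<close> and
  \<open>x \<in> \<Omega>\<close>.\<close>

theorem theorem1p4:
  fixes G :: "'a pair_pre_digraph"
    and w :: "'a \<Rightarrow> 'a \<Rightarrow> real" and m :: "'a \<Rightarrow> real"
    and \<Omega> :: "'a set" and N :: nat
    and \<phi> :: "nat \<Rightarrow> 'a \<Rightarrow> real" and lam :: "nat \<Rightarrow> real"
    and f :: "real \<Rightarrow> 'a \<Rightarrow> real" and g h :: "'a \<Rightarrow> real"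
    and b :: "nat \<Rightarrow> real \<Rightarrow> real" and gc hc :: "nat \<Rightarrow> real"
    and u :: "real \<Rightarrow> 'a \<Rightarrow> real"
  assumes graph: "weighted_graph G w m"
    and dom: "is_domain G \<Omega>"
    and interior_ne: "vertex_interior G \<Omega> \<noteq> {}"
    and N_def: "N = card (vertex_interior G \<Omega>)"
    and basis: "orthonormal_basis_W012 G m \<Omega> N \<phi>"
    and eigen: "\<forall>k\<in>{1..N}. \<forall>x\<in>vertex_interior G \<Omega>.
                  - dirichlet_laplacian G w m \<Omega> (\<phi> k) x = lam k * \<phi> k x"
    and lam_pos: "\<forall>k\<in>{1..N}. lam k > 0"
    and f_cont: "\<forall>x\<in>vertex_interior G \<Omega>. continuous_on {0..} (\<lambda>t. f t x)"
    and f_exp: "\<forall>t\<ge>0. \<forall>x\<in>vertex_interior G \<Omega>. f t x = (\<Sum>k=1..N. b k t * \<phi> k x)"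
    and g_exp: "\<forall>x\<in>vertex_interior G \<Omega>. g x = (\<Sum>k=1..N. gc k * \<phi> k x)"
    and h_exp: "\<forall>x\<in>vertex_interior G \<Omega>. h x = (\<Sum>k=1..N. hc k * \<phi> k x)"
  shows "wave_solution G w m \<Omega> f g h u \<longleftrightarrow>
    (\<forall>t\<ge>0. \<forall>x\<in>\<Omega>. u t x =
        (\<Sum>k=1..N. 1 / sqrt (lam k)
            * integral {0..t} (\<lambda>s. sin (sqrt (lam k) * (t - s)) * b k s) * \<phi> k x)
      + (\<Sum>k=1..N. gc k * cos (sqrt (lam k) * t) * \<phi> k x)
      + (\<Sum>k=1..N. 1 / sqrt (lam k) * hc k * sin (sqrt (lam k) * t) * \<phi> k x))"
proof -
  let ?I = "vertex_interior G \<Omega>"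
  let ?o = "\<lambda>k. oscillator (lam k) (b k) (gc k) (hc k)"
  let ?c = "\<lambda>k v. inner_dom m \<Omega> v (\<phi> k)"
  have I: "x \<in> \<Omega>" if "x \<in> ?I" for x
    using that by (simp add: vertex_interior_def)
  have zero: "\<phi> k x = 0" if "k \<in> {1..N}" "x \<in> vertex_boundary G \<Omega>" for k x
    using basis that by (auto simp: orthonormal_basis_W012_def W012_def)
  \<comment> \<open>In the eigenbasis the Laplacian is diagonal: it multiplies the
    \<open>k\<close>-th coefficient by \<open>- lam k\<close>.\<close>
  have laplacian: "dirichlet_laplacian G w m \<Omega> v x = (\<Sum>k=1..N. - (lam k * a k) * \<phi> k x)"
    if "x \<in> ?I" "\<And>y. y \<in> ?I \<Longrightarrow> v y = (\<Sum>k=1..N. a k * \<phi> k y)" for v a x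
  proof -
    have "dirichlet_laplacian G w m \<Omega> (\<phi> k) x = - (lam k * \<phi> k x)" if "k \<in> {1..N}" for k
      using eigen \<open>x \<in> ?I\<close> that by (metis minus_minus)
    then show ?thesis
      using dirichlet_laplacian_sum[OF that, where w = w and m = m] by (simp add: algebra_simps)
  qed
  \<comment> \<open>Continuity passes from \<open>f\<close> to its coefficients, since
    \<open>b k t\<close> is the finite sum \<open>inner_dom m \<Omega> (f t) (\<phi> k)\<close>. At
    boundary points the summand is identically 0.\<close>
  have b_cont: "continuous_on {0..} (b k)" if k: "k \<in> {1..N}" for k
  proof -
    have "continuous_on {0..} (\<lambda>t. \<Sum>x\<in>\<Omega>. f t x * \<phi> k x * m x)"
    proof (rule continuous_on_sum)
      fix x assume "x \<in> \<Omega>"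
      show "continuous_on {0..} (\<lambda>t. f t x * \<phi> k x * m x)"
      proof (cases "x \<in> vertex_boundary G \<Omega>")
        case False
        then show ?thesis
          using f_cont \<open>x \<in> \<Omega>\<close> by (auto intro!: continuous_intros simp: vertex_interior_def)
      qed (simp add: zero[OF k])
    qed
    moreover have "(\<Sum>x\<in>\<Omega>. f t x * \<phi> k x * m x) = b k t" if "t \<in> {0..}" for t
      using W012_coefficient[OF basis k, of "f t" "\<lambda>j. b j t"] f_exp that
      by (simp add: inner_dom_def)
    ultimately show ?thesis
      by (rule continuous_on_eq)
  qed
  have formula: "(\<Sum>k=1..N. 1 / sqrt (lam k)
            * integral {0..t} (\<lambda>s. sin (sqrt (lam k) * (t - s)) * b k s) * \<phi> k x)
      + (\<Sum>k=1..N. gc k * cos (sqrt (lam k) * t) * \<phi> k x)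
      + (\<Sum>k=1..N. 1 / sqrt (lam k) * hc k * sin (sqrt (lam k) * t) * \<phi> k x)
      = (\<Sum>k=1..N. ?o k t * \<phi> k x)" for t x
    by (simp only: oscillator_def distrib_right sum.distrib)
  have "wave_solution G w m \<Omega> f g h u \<longleftrightarrow> (\<forall>t\<ge>0. \<forall>x\<in>\<Omega>. u t x = (\<Sum>k=1..N. ?o k t * \<phi> k x))"
  proof (intro iffI allI impI ballI)
    fix t x
    assume t: "(t::real) \<ge> 0" and x: "x \<in> \<Omega>"
    assume "wave_solution G w m \<Omega> f g h u"
    then obtain du ddu where
      deriv: "\<forall>x\<in>\<Omega>.
           (\<forall>t\<ge>0. ((\<lambda>s. u s x) has_real_derivative du t x) (at t within {0..})) \<and>
           (\<forall>t\<ge>0. ((\<lambda>s. du s x) has_real_derivative ddu t x) (at t within {0..})) \<and>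
           continuous_on {0..} (\<lambda>t. ddu t x)"
      and eq: "\<forall>t\<ge>0. \<forall>x\<in>?I. ddu t x - dirichlet_laplacian G w m \<Omega> (u t) x = f t x"
      and u0: "\<forall>x\<in>?I. u 0 x = g x" and du0: "\<forall>x\<in>?I. du 0 x = h x"
      and bd: "\<forall>t\<ge>0. \<forall>x\<in>vertex_boundary G \<Omega>. u t x = 0"
      unfolding wave_solution_def by (elim exE conjE)
    have du: "((\<lambda>s. u s x) has_real_derivative du t x) (at t within {0..})"
      and ddu: "((\<lambda>s. du s x) has_real_derivative ddu t x) (at t within {0..})"
      if "x \<in> \<Omega>" "t \<ge> 0" for x t
      using deriv that by simp_all
    \<comment> \<open>The Dirichlet condition places \<open>u t\<close> in
      \<open>W012 G \<Omega>\<close>.\<close>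
    have u_exp: "u t x = (\<Sum>k=1..N. ?c k (u t) * \<phi> k x)" if "t \<ge> 0" "x \<in> \<Omega>" for t x
      using bd that by (intro W012_expansion[OF basis]) (auto simp: W012_def)
    have ddu_exp: "ddu t x = (\<Sum>k=1..N. (b k t - lam k * ?c k (u t)) * \<phi> k x)"
      if "t \<ge> 0" "x \<in> ?I" for t x
    proof -
      have "dirichlet_laplacian G w m \<Omega> (u t) x = (\<Sum>k=1..N. - (lam k * ?c k (u t)) * \<phi> k x)"
        using that by (intro laplacian u_exp I)
      then have "ddu t x = (\<Sum>k=1..N. b k t * \<phi> k x) + (\<Sum>k=1..N. - (lam k * ?c k (u t)) * \<phi> k x)"
        using eq f_exp that by (simp add: diff_eq_eq)
      then show ?thesis
        by (simp add: sum.distrib[symmetric] algebra_simps)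
    qed
    \<comment> \<open>Projecting the equation onto \<open>\<phi> k\<close> leaves a scalar
      oscillator equation for the coefficient, to which uniqueness applies.\<close>
    have "?c k (u t) = ?o k t" if k: "k \<in> {1..N}" for k
    proof -
      have "((\<lambda>s. ?c k (du s)) has_real_derivative b k t - lam k * ?c k (u t)) (at t within {0..})"
        if "t \<ge> 0" for t
      proof -
        have "((\<lambda>s. ?c k (du s)) has_real_derivative ?c k (ddu t)) (at t within {0..})"
          using ddu that by (intro inner_dom_has_real_derivative)
        moreover have "?c k (ddu t) = b k t - lam k * ?c k (u t)"
          using ddu_exp that by (intro W012_coefficient[OF basis k])
        ultimately show ?thesis by simp
      qed
      then have "?c k (u t) = oscillator (lam k) (b k) (?c k (u 0)) (?c k (du 0)) t"
        using lam_pos k t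
        by (intro oscillator_unique[where d = "\<lambda>s. ?c k (du s)"] b_cont inner_dom_has_real_derivative du)
          auto
      moreover have "?c k (u 0) = gc k" "?c k (du 0) = hc k"
        using u0 g_exp du0 h_exp by (auto intro!: W012_coefficient[OF basis k])
      ultimately show ?thesis by simp
    qed
    then show "u t x = (\<Sum>k=1..N. ?o k t * \<phi> k x)"
      using u_exp[OF t x] by simp
  next
    assume u: "\<forall>t\<ge>0. \<forall>x\<in>\<Omega>. u t x = (\<Sum>k=1..N. ?o k t * \<phi> k x)"
    \<comment> \<open>Packing the three properties into one existential allows a choice over
      \<open>k\<close>, giving a single family of velocities.\<close>
    have "\<exists>v. (\<forall>t\<ge>0. (?o k has_real_derivative v t) (at t within {0..})) \<and>
        (\<forall>t\<ge>0. (v has_real_derivative b k t - lam k * ?o k t) (at t within {0..})) \<and> v 0 = hc k"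
      if k: "k \<in> {1..N}" for k
    proof -
      have "lam k > 0" using lam_pos k by blast
      with b_cont[OF k] show ?thesis
        by (rule oscillator_solution[of _ _ "gc k" "hc k"]) blast
    qed
    then obtain v where
      o': "\<And>k t. k \<in> {1..N} \<Longrightarrow> t \<ge> 0 \<Longrightarrow> (?o k has_real_derivative v k t) (at t within {0..})"
      and v': "\<And>k t. k \<in> {1..N} \<Longrightarrow> t \<ge> 0 \<Longrightarrow>
          (v k has_real_derivative b k t - lam k * ?o k t) (at t within {0..})"
      and v0: "\<And>k. k \<in> {1..N} \<Longrightarrow> v k 0 = hc k"
      by (metis (no_types))
    have o_cont: "continuous_on {0..} (?o k)" if "k \<in> {1..N}" for k
      using o'[OF that] by (intro DERIV_continuous_on) auto
    define du where "du = (\<lambda>t x. \<Sum>k=1..N. v k t * \<phi> k x)"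
    \<comment> \<open>The scalar equations replace each second derivative, so continuity of
      \<open>ddu\<close> reduces to that of \<open>b k\<close> and the oscillators.\<close>
    define ddu where "ddu = (\<lambda>t x. \<Sum>k=1..N. (b k t - lam k * ?o k t) * \<phi> k x)"
    have "((\<lambda>s. u s x) has_real_derivative du t x) (at t within {0..})" if "x \<in> \<Omega>" "t \<ge> 0" for t x
    \<comment> \<open>\<open>u\<close> is known to equal the sum only for nonnegative times, so the
      sum is differentiated and the result transferred within the half-line; the radius 1 is
      arbitrary.\<close>
    proof (rule has_field_derivative_transform_within[where d = 1 and f = "\<lambda>s. \<Sum>k=1..N. ?o k s * \<phi> k x"])
      show "((\<lambda>s. \<Sum>k=1..N. ?o k s * \<phi> k x) has_real_derivative du t x) (at t within {0..})"
        unfolding du_def using that by (auto intro!: DERIV_sum DERIV_cmult_right o')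
    qed (use u that in auto)
    moreover have "((\<lambda>s. du s x) has_real_derivative ddu t x) (at t within {0..})" if "t \<ge> 0" for t x
      unfolding du_def ddu_def using that by (auto intro!: DERIV_sum DERIV_cmult_right v')
    moreover have "continuous_on {0..} (\<lambda>t. ddu t x)" for x
      unfolding ddu_def by (auto intro!: continuous_intros b_cont o_cont)
    moreover have "ddu t x - dirichlet_laplacian G w m \<Omega> (u t) x = f t x" if "t \<ge> 0" "x \<in> ?I" for t x
    proof -
      have "dirichlet_laplacian G w m \<Omega> (u t) x = (\<Sum>k=1..N. - (lam k * ?o k t) * \<phi> k x)"
        using that u I by (intro laplacian) auto
      then show ?thesis
        using f_exp that by (simp add: ddu_def sum_subtractf[symmetric] algebra_simps)
    qed
    moreover have "u 0 x = g x" "du 0 x = h x" if "x \<in> ?I" for x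
      using u I[OF that] g_exp h_exp that by (simp_all add: oscillator_0 du_def v0)
    moreover have "u t x = 0" if "t \<ge> 0" "x \<in> vertex_boundary G \<Omega>" for t x
      using u that zero by (simp add: vertex_boundary_def)
    ultimately show "wave_solution G w m \<Omega> f g h u"
      unfolding wave_solution_def
      by (intro exI[of _ du] exI[of _ ddu] conjI ballI allI impI)
  qed
  then show ?thesis
    by (simp only: formula)
qed

end
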